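(* Let $c:\mathbb{R}^d\times\mathbb{R}^d\to\mathbb{R}$ be a cost function such that $x\mapsto c(x,y)$ is locally Lipschitz with local Lipschitz constants uniformly bounded in $y$, and $y\mapsto c(x,y)$ is locally Lipschitz with local Lipschitz constants uniformly bounded in $x$. Let $\Gamma\subset\mathbb{R}^d\times\mathbb{R}^d$ be a Borel set in $\mathcal{S}_{MT}$ that is a $c$-contact layer, and suppose that $X_\Gamma\subset\Omega:=IC(Y_\Gamma)$ with $\Omega$ an open set in $\mathbb{R}^d$. Then: (1) There exist a locally Lipschitz function $\alpha:\Omega\to\mathbb{R}$, a locally bounded function $\gamma:\Omega\to\mathbb{R}^d$, and a function $\beta:\mathbb{R}^d\to\mathbb{R}$ such that $\Gamma$ is a $c$-contact layer for the triplet $(\alpha,\gamma,\beta)$. (2) If the admissible triple exposing $\Gamma$ is in $E_M(c,X_\Gamma,Y_\Gamma)$ and $y\mapsto c(x,y)$ is convex, then $\beta$ in (1) can be taken to be a convex function on $\mathbb{R}^d$. (3) If $c(x,y)=|x-y|$ and the admissible triple exposing $\Gamma$ is in $E_m(c,X_\Gamma,Y_\Gamma)$, then the functions in (1) can be taken with $\alpha=\beta$ on $\Omega$.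
   Context: For $A\subset\mathbb{R}^d$, $V(A)$ is the lowest-dimensional affine space containing $A$, and $IC(A):=\mathrm{int}(\mathrm{conv}(A))$, the interior being taken in the topology of $V(A)$ (so $IC(\{x\})=\{x\}$). For $\Gamma\subset\mathbb{R}^d\times\mathbb{R}^d$: $\Gamma_x:=\{y:(x,y)\in\Gamma\}$, and $X_\Gamma$, $Y_\Gamma$ are the projections of $\Gamma$ onto the first and second coordinate spaces. $\mathcal{S}_{MT}$ is the class of martingale supporting sets: Borel sets $\Gamma\subset\mathbb{R}^d\times\mathbb{R}^d$ with $x\in IC(\Gamma_x)$ for every $x\in X_\Gamma$. For sets $X,Y\subset\mathbb{R}^d$, a triplet of measurable functions $\alpha:X\to\mathbb{R}$, $\gamma:X\to\mathbb{R}^d$, $\beta:Y\to\mathbb{R}$ is an admissible triple in $E_m(c,X,Y)$ if $\beta(y)-\alpha(x)-\gamma(x)\cdot(y-x)\le c(x,y)$ for all $(x,y)\in X\times Y$; it is in $E_M(c,X,Y)$ if the reverse inequality holds. For an admissible triple (of either type), $\Gamma_{(\alpha,\gamma,\beta)}:=\{(x,y)\in X\times Y:\beta(y)-\alpha(x)-\gamma(x)\cdot(y-x)=c(x,y)\}$, and any nonempty subset of $\Gamma_{(\alpha,\gamma,\beta)}$ is called a $c$-contact layer for $(\alpha,\gamma,\beta)$ in $X\times Y$ (exposed by that triple). When the ambient space is not specified it is $X_\Gamma\times Y_\Gamma$ (functions defined on larger sets being restricted). A set is a $c$-contact layer if it is one for some admissible triple.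
   Formalization: In (2), β is proved to be a convex function on R^d with values in (−∞,+∞], finite on conv(Y_Γ), rather than real-valued on all of R^d; a real-valued convex β need not exist, as its slopes may blow up at a boundary point of Ω. *)

theory Defs
  imports "HOL-Analysis.Analysis"
begin

text \<open>\<open>rel_interior\<close> is the interior relative to the affine hull, and a set and its convex hull
  have the same affine hull.\<close>

definition IC :: "'a::euclidean_space set \<Rightarrow> 'a set" where
  "IC A = rel_interior (convex hull A)"

text \<open>The projections of \<open>\<Gamma>\<close> are \<open>fst ` \<Gamma>\<close> and \<open>snd ` \<Gamma>\<close>, its section at \<open>x\<close> is
  \<open>\<Gamma> `` {x}\<close>.\<close>

definition S_MT :: "('a::euclidean_space \<times> 'a) set set" where
  "S_MT = {\<Gamma>. \<Gamma> \<in> sets borel \<and> (\<forall>x\<in>fst ` \<Gamma>. x \<in> IC (\<Gamma> `` {x}))}"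

type_synonym 'a triple = "('a \<Rightarrow> real) \<times> ('a \<Rightarrow> 'a) \<times> ('a \<Rightarrow> real)"

text \<open>Functions on \<open>X\<close> or \<open>Y\<close> are total functions of which only the restriction to \<open>X\<close> or \<open>Y\<close>
  is constrained; measurability refers to the trace of the Borel sigma-algebra, since \<open>X\<close> and
  \<open>Y\<close> (e.g. projections of a Borel set) need not be Borel.\<close>

definition meas_triple :: "'a::euclidean_space set \<Rightarrow> 'a set \<Rightarrow> 'a triple set" where
  "meas_triple X Y = {(\<alpha>, \<gamma>, \<beta>).
     \<alpha> \<in> borel_measurable (restrict_space borel X) \<and>
     \<gamma> \<in> borel_measurable (restrict_space borel X) \<and>
     \<beta> \<in> borel_measurable (restrict_space borel Y)}"

definition E_min :: "('a::euclidean_space \<Rightarrow> 'a \<Rightarrow> real) \<Rightarrow> 'a set \<Rightarrow> 'a set \<Rightarrow> 'a triple set" where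
  "E_min c X Y = {(\<alpha>, \<gamma>, \<beta>). (\<alpha>, \<gamma>, \<beta>) \<in> meas_triple X Y \<and>
     (\<forall>x\<in>X. \<forall>y\<in>Y. \<beta> y - \<alpha> x - \<gamma> x \<bullet> (y - x) \<le> c x y)}"

definition E_max :: "('a::euclidean_space \<Rightarrow> 'a \<Rightarrow> real) \<Rightarrow> 'a set \<Rightarrow> 'a set \<Rightarrow> 'a triple set" where
  "E_max c X Y = {(\<alpha>, \<gamma>, \<beta>). (\<alpha>, \<gamma>, \<beta>) \<in> meas_triple X Y \<and>
     (\<forall>x\<in>X. \<forall>y\<in>Y. \<beta> y - \<alpha> x - \<gamma> x \<bullet> (y - x) \<ge> c x y)}"

definition contact_set ::
  "('a::euclidean_space \<Rightarrow> 'a \<Rightarrow> real) \<Rightarrow> 'a set \<Rightarrow> 'a set \<Rightarrow> 'a triple \<Rightarrow> ('a \<times> 'a) set" where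
  "contact_set c X Y t = (case t of (\<alpha>, \<gamma>, \<beta>) \<Rightarrow>
     {(x, y) \<in> X \<times> Y. \<beta> y - \<alpha> x - \<gamma> x \<bullet> (y - x) = c x y})"

definition contact_layer_in ::
  "('a::euclidean_space \<Rightarrow> 'a \<Rightarrow> real) \<Rightarrow> 'a set \<Rightarrow> 'a set \<Rightarrow> 'a triple \<Rightarrow> ('a \<times> 'a) set \<Rightarrow> bool"
where
  "contact_layer_in c X Y t \<Gamma> \<longleftrightarrow>
     t \<in> E_min c X Y \<union> E_max c X Y \<and> \<Gamma> \<noteq> {} \<and> \<Gamma> \<subseteq> contact_set c X Y t"

text \<open>When no ambient product is named, it is the product of the two projections.\<close>

definition contact_layer ::
  "('a::euclidean_space \<Rightarrow> 'a \<Rightarrow> real) \<Rightarrow> 'a triple \<Rightarrow> ('a \<times> 'a) set \<Rightarrow> bool" where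
  "contact_layer c t \<Gamma> \<longleftrightarrow> contact_layer_in c (fst ` \<Gamma>) (snd ` \<Gamma>) t \<Gamma>"

definition locally_lipschitz_on :: "'a::metric_space set \<Rightarrow> ('a \<Rightarrow> 'b::metric_space) \<Rightarrow> bool" where
  "locally_lipschitz_on S f \<longleftrightarrow>
     (\<forall>x\<in>S. \<exists>r>0. \<exists>L. L-lipschitz_on (cball x r \<inter> S) f)"

text \<open>One neighbourhood and one constant serve all members of the family. On a Euclidean space this
  is the same as one constant per compact set. The library's \<open>local_lipschitz\<close> is uniform only
  locally in the parameter, hence weaker.\<close>

definition uniformly_locally_lipschitz :: "('i \<Rightarrow> 'a::metric_space \<Rightarrow> 'b::metric_space) \<Rightarrow> bool" where
  "uniformly_locally_lipschitz F \<longleftrightarrow>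
     (\<forall>x. \<exists>r>0. \<exists>L. \<forall>i. L-lipschitz_on (cball x r) (F i))"

definition locally_bounded_on :: "'a::metric_space set \<Rightarrow> ('a \<Rightarrow> 'b::metric_space) \<Rightarrow> bool" where
  "locally_bounded_on S f \<longleftrightarrow> (\<forall>x\<in>S. \<exists>r>0. bounded (f ` (cball x r \<inter> S)))"

text \<open>Convexity of a function on the whole space with values in \<open>(-\<infinity>, \<infinity>]\<close>, in the usual sense of
  convex analysis: the epigraph is convex. The value \<open>\<infinity>\<close> is needed: for \<open>c x y = norm (x - y)\<close>
  on the line, a contact layer whose second projection contains points \<open>2 - 1 / 2 ^ k\<close>
  can force the slopes of \<open>\<beta>\<close> to tend to \<open>\<infinity>\<close> at the boundary point \<open>2\<close> of \<open>\<Omega>\<close>, and such a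
  \<open>\<beta>\<close> has no finite convex extension past \<open>2\<close>.\<close>

definition ext_convex :: "('a::real_vector \<Rightarrow> ereal) \<Rightarrow> bool" where
  "ext_convex f \<longleftrightarrow> (\<forall>x. f x \<noteq> -\<infinity>) \<and> convex {(x, t). f x \<le> ereal t}"

end

theory Submission
  imports Defs
begin

text \<open>Write \<open>X\<close> and \<open>Y\<close> for the two projections of \<open>\<Gamma>\<close>. The idea is to leave the triple
  exposing \<open>\<Gamma>\<close> untouched on \<open>X \<times> Y\<close>, where admissibility, contact and measurability are already
  known, and to show that it has regular extensions. By the symmetry
  \<open>(c, \<alpha>, \<gamma>, \<beta>) \<mapsto> (- c, - \<alpha>, - \<gamma>, - \<beta>)\<close> suppose that \<open>c\<close> is dominated from above. Then for every
  \<open>x \<in> X\<close> the affine function \<open>\<alpha>(x) + \<gamma>(x) \<bullet> (y - x)\<close> of \<open>y\<close> is a minorant on \<open>Y\<close> of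
  \<open>F\<^sub>x(y) = \<beta>(y) - c(x, y)\<close>, with equality on the section \<open>\<Gamma>\<^sub>x\<close>. Let \<open>H(x, z)\<close> be the convex envelope
  of \<open>F\<^sub>x\<close> over \<open>Y\<close>, the supremum at \<open>z\<close> of its affine minorants.

  As \<open>x\<close> is a convex combination of points of \<open>\<Gamma>\<^sub>x\<close>, no affine minorant exceeds \<open>\<alpha>(x)\<close> at
  \<open>x\<close>, so \<open>\<alpha>(x) = H(x, x)\<close> and \<open>\<gamma>(x)\<close> is a subgradient of \<open>H(x, \<cdot>)\<close> at \<open>x\<close>
  (\<open>convex_envelope_eq_of_contact\<close>). The diagonal \<open>x \<mapsto> H(x, x)\<close> makes sense on all of \<open>\<Omega>\<close> and is the
  extension of \<open>\<alpha>\<close>. It is locally Lipschitz: in the first variable \<open>H\<close> inherits the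
  Lipschitz constants of \<open>c\<close>, uniform in \<open>y\<close>; in the second it is convex and bounded on small balls,
  uniformly in the first (\<open>convex_envelope_family_local_bounds\<close>), hence Lipschitz with a uniform
  constant. The same bounds control the subgradients \<open>\<gamma>(x)\<close>, which are extended by \<open>0\<close> off \<open>X\<close>.
  These facts are collected in \<open>dominating_triple_regularity\<close>.

  If \<open>c(x, \<cdot>)\<close> is convex, then \<open>\<beta>\<close> is recovered on \<open>Y\<close> as the supremum over \<open>x \<in> X\<close> of the convex
  functions \<open>c(x, y) + \<alpha>(x) + \<gamma>(x) \<bullet> (y - x)\<close>, which is convex on the whole space. If \<open>c\<close> is the
  distance and the triple lies below it, then, after the change of signs, the triangle inequality
  forces the diagonal of the envelope to take the value \<open>\<beta>(y)\<close> at each \<open>y \<in> Y\<close>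
  (\<open>diagonal_convex_envelope_eq_of_contact\<close>), so a single function serves as \<open>\<alpha>\<close> and
  \<open>\<beta>\<close>.\<close>

section \<open>Convex envelopes over a set\<close>

definition affine_minorants :: "'a::real_inner set \<Rightarrow> ('a \<Rightarrow> real) \<Rightarrow> (real \<times> 'a) set" where
  "affine_minorants Y f = {(a, g). \<forall>y\<in>Y. a + g \<bullet> y \<le> f y}"

definition convex_envelope :: "'a::real_inner set \<Rightarrow> ('a \<Rightarrow> real) \<Rightarrow> 'a \<Rightarrow> real" where
  "convex_envelope Y f z = (SUP (a, g)\<in>affine_minorants Y f. a + g \<bullet> z)"

text \<open>The points at which all affine minorants of \<open>f\<close> have a common upper bound form a convex set
  containing \<open>Y\<close>, whatever \<open>f\<close> is. So on the convex hull of \<open>Y\<close> the supremum defining the envelope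
  is a genuine one as soon as \<open>f\<close> has an affine minorant; elsewhere it may be a junk value.\<close>

lemma bdd_above_affine_minorants:
  assumes "z \<in> convex hull Y"
  shows "bdd_above ((\<lambda>(a, g). a + g \<bullet> z) ` affine_minorants Y f)"
proof -
  let ?S = "{z. \<exists>B. \<forall>(a, g)\<in>affine_minorants Y f. a + g \<bullet> z \<le> B}"
  have "Y \<subseteq> ?S"
    by (auto simp: affine_minorants_def)
  moreover have "convex ?S"
  proof (rule convexI)
    fix x y and u v :: real
    assume x: "x \<in> ?S" and y: "y \<in> ?S" and uv: "0 \<le> u" "0 \<le> v" "u + v = 1"
    from x obtain B where B: "\<And>a g. (a, g) \<in> affine_minorants Y f \<Longrightarrow> a + g \<bullet> x \<le> B" by auto
    from y obtain C where C: "\<And>a g. (a, g) \<in> affine_minorants Y f \<Longrightarrow> a + g \<bullet> y \<le> C" by auto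
    have "a + g \<bullet> (u *\<^sub>R x + v *\<^sub>R y) \<le> u * B + v * C" if "(a, g) \<in> affine_minorants Y f" for a g
    proof -
      have "a + g \<bullet> (u *\<^sub>R x + v *\<^sub>R y) = (u + v) * a + u * (g \<bullet> x) + v * (g \<bullet> y)"
        using uv by (simp add: inner_add_right)
      also have "\<dots> = u * (a + g \<bullet> x) + v * (a + g \<bullet> y)"
        by (simp add: algebra_simps)
      also have "\<dots> \<le> u * B + v * C"
        using B[OF that] C[OF that] uv by (intro add_mono mult_left_mono) auto
      finally show ?thesis .
    qed
    then show "u *\<^sub>R x + v *\<^sub>R y \<in> ?S" by blast
  qed
  ultimately have "convex hull Y \<subseteq> ?S"
    by (rule hull_minimal)
  with assms show ?thesis
    by (fastforce simp: bdd_above_def)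
qed

lemma convex_envelope_upper:
  assumes "(a, g) \<in> affine_minorants Y f" "z \<in> convex hull Y"
  shows "a + g \<bullet> z \<le> convex_envelope Y f z"
  using cSUP_upper[OF assms(1) bdd_above_affine_minorants[OF assms(2)]]
  by (simp add: convex_envelope_def)

lemma convex_envelope_least:
  assumes "affine_minorants Y f \<noteq> {}"
    and "\<And>a g. (a, g) \<in> affine_minorants Y f \<Longrightarrow> a + g \<bullet> z \<le> B"
  shows "convex_envelope Y f z \<le> B"
  unfolding convex_envelope_def using assms by (intro cSUP_least) auto

lemma convex_on_convex_envelope:
  assumes "affine_minorants Y f \<noteq> {}"
  shows "convex_on (convex hull Y) (convex_envelope Y f)"
  unfolding convex_on_def
proof (intro conjI ballI allI impI convex_convex_hull)
  fix x y and u v :: real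
  assume x: "x \<in> convex hull Y" and y: "y \<in> convex hull Y" and uv: "0 \<le> u" "0 \<le> v" "u + v = 1"
  show "convex_envelope Y f (u *\<^sub>R x + v *\<^sub>R y)
      \<le> u * convex_envelope Y f x + v * convex_envelope Y f y"
  proof (rule convex_envelope_least[OF assms])
    fix a g assume ag: "(a, g) \<in> affine_minorants Y f"
    have "a + g \<bullet> (u *\<^sub>R x + v *\<^sub>R y) = (u + v) * a + u * (g \<bullet> x) + v * (g \<bullet> y)"
      using uv by (simp add: inner_add_right)
    also have "\<dots> = u * (a + g \<bullet> x) + v * (a + g \<bullet> y)"
      by (simp add: algebra_simps)
    also have "\<dots> \<le> u * convex_envelope Y f x + v * convex_envelope Y f y"
      using convex_envelope_upper[OF ag] x y uv by (intro add_mono mult_left_mono) auto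
    finally show "a + g \<bullet> (u *\<^sub>R x + v *\<^sub>R y)
      \<le> u * convex_envelope Y f x + v * convex_envelope Y f y" .
  qed
qed

lemma affine_minorants_shift:
  assumes "(a, g) \<in> affine_minorants Y f" "\<And>y. y \<in> Y \<Longrightarrow> f y - K \<le> h y"
  shows "(a - K, g) \<in> affine_minorants Y h"
  using assms by (fastforce simp: affine_minorants_def)

text \<open>The envelope is monotone and commutes with additive constants. A uniform bound on
  the difference of two functions is therefore inherited by their envelopes.\<close>

lemma convex_envelope_shift:
  assumes "affine_minorants Y f \<noteq> {}" "\<And>y. y \<in> Y \<Longrightarrow> f y - K \<le> h y" "z \<in> convex hull Y"
  shows "convex_envelope Y f z - K \<le> convex_envelope Y h z"
proof -
  have "convex_envelope Y f z \<le> convex_envelope Y h z + K"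
    using convex_envelope_upper[OF affine_minorants_shift[OF _ assms(2)] assms(3)]
    by (intro convex_envelope_least[OF assms(1)]) force
  then show ?thesis by simp
qed

section \<open>Envelopes of a uniformly Lipschitz family\<close>

text \<open>Prolong the segment from \<open>x\<close> to \<open>y\<close> by length \<open>r\<close>, which stays in the doubled ball. By convexity
  the slope from \<open>x\<close> to \<open>y\<close> is at most that along the prolonged segment, whose length is at least
  \<open>r\<close> and along which \<open>f\<close> varies by at most \<open>2 * M\<close>.\<close>

lemma convex_on_bounded_imp_lipschitz:
  fixes f :: "'a::real_normed_vector \<Rightarrow> real"
  assumes f: "convex_on (cball x0 (2 * r)) f" and r: "r > 0"
    and M: "\<And>z. z \<in> cball x0 (2 * r) \<Longrightarrow> \<bar>f z\<bar> \<le> M"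
  shows "(2 * M / r)-lipschitz_on (cball x0 r) f"
proof -
  have M0: "M \<ge> 0"
    using M[of x0] r by auto
  have *: "f y - f x \<le> 2 * M / r * dist x y" if x: "x \<in> cball x0 r" and y: "y \<in> cball x0 r" for x y
  proof (cases "x = y")
    case False
    define d where "d = norm (y - x)"
    have d: "d > 0" using False by (simp add: d_def)
    define w where "w = y + (r / d) *\<^sub>R (y - x)"
    have "dist x0 w \<le> dist x0 y + dist y w"
      by (rule dist_triangle)
    also have "dist y w = r"
      using r d by (simp add: w_def dist_norm d_def)
    finally have w: "w \<in> cball x0 (2 * r)"
      using y by simp
    define t where "t = d / (d + r)"
    have t: "0 \<le> t" "t \<le> 1" "t \<le> d / r"
      using d r by (auto simp: t_def field_simps)
    have "t * (1 + r / d) = 1"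
    proof -
      have "1 + r / d = (d + r) / d"
        using d by (simp add: add_divide_distrib)
      then show ?thesis
        using d r by (simp add: t_def)
    qed
    then have "y - x = (t * (1 + r / d)) *\<^sub>R (y - x)"
      by simp
    then have y_eq: "y = (1 - t) *\<^sub>R x + t *\<^sub>R w"
      by (simp add: w_def algebra_simps)
    have x2: "x \<in> cball x0 (2 * r)"
      using x r by simp
    have "f y \<le> (1 - t) * f x + t * f w"
      using convex_onD[OF f t(1,2) x2 w] y_eq by simp
    then have "f y - f x \<le> t * (f w - f x)"
      by (simp add: algebra_simps)
    also have "\<dots> \<le> t * (2 * M)"
      using M[OF w] M[OF x2] t by (intro mult_left_mono) auto
    also have "\<dots> \<le> d / r * (2 * M)"
      using t M0 by (intro mult_right_mono) auto
    finally show ?thesis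
      by (simp add: d_def dist_norm norm_minus_commute mult.commute)
  qed simp
  show ?thesis
  proof (rule lipschitz_onI)
    fix x y assume "x \<in> cball x0 r" "y \<in> cball x0 r"
    then show "dist (f x) (f y) \<le> 2 * M / r * dist x y"
      using *[of x y] *[of y x] by (simp add: dist_real_def dist_commute abs_if)
  qed (use M0 r in simp)
qed

text \<open>Having uniformly bounded difference is an equivalence relation between points. Its classes are
  open because the local constants are uniform, so by connectedness there is only one.\<close>

lemma uniformly_locally_lipschitz_bounded_difference:
  fixes F :: "'i \<Rightarrow> 'a::euclidean_space \<Rightarrow> real"
  assumes "uniformly_locally_lipschitz F"
  shows "\<exists>B. \<forall>i. \<bar>F i x - F i y\<bar> \<le> B"
proof (rule connected_equivalence_relation
    [where S = UNIV and R = "\<lambda>x y. \<exists>B. \<forall>i. \<bar>F i x - F i y\<bar> \<le> B"])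
  fix x y assume "\<exists>B. \<forall>i. \<bar>F i x - F i y\<bar> \<le> B"
  then show "\<exists>B. \<forall>i. \<bar>F i y - F i x\<bar> \<le> B"
    by (simp add: abs_minus_commute)
next
  fix x y z
  assume "\<exists>B. \<forall>i. \<bar>F i x - F i y\<bar> \<le> B" "\<exists>B. \<forall>i. \<bar>F i y - F i z\<bar> \<le> B"
  then obtain B C where "\<And>i. \<bar>F i x - F i y\<bar> \<le> B" "\<And>i. \<bar>F i y - F i z\<bar> \<le> C" by blast
  then have "\<bar>F i x - F i z\<bar> \<le> B + C" for i
    by (smt (verit, ccfv_threshold))
  then show "\<exists>B. \<forall>i. \<bar>F i x - F i z\<bar> \<le> B" by blast
next
  fix a
  obtain r L where r: "r > 0" and L: "\<And>i. L-lipschitz_on (cball a r) (F i)"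
    using assms unfolding uniformly_locally_lipschitz_def by blast
  have "\<bar>F i a - F i x\<bar> \<le> L * dist a x" if "x \<in> ball a r" for i x
    using lipschitz_onD[OF L, of a x] that r by (simp add: dist_real_def)
  then show "\<exists>T. openin (top_of_set UNIV) T \<and> a \<in> T \<and> (\<forall>x\<in>T. \<exists>B. \<forall>i. \<bar>F i a - F i x\<bar> \<le> B)"
    using r by (intro exI[of _ "ball a r"] conjI ballI) (simp, simp, blast)
qed auto

text \<open>An affine minorant for one parameter gives one for every other parameter, after lowering it by a
  constant. This is how admissibility at a single point of \<open>X\<close> makes the envelopes meaningful at
  all points of \<open>\<Omega>\<close>.\<close>

lemma affine_minorants_nonempty_family:
  fixes F :: "'a::euclidean_space \<Rightarrow> 'a \<Rightarrow> real"
  assumes lip: "uniformly_locally_lipschitz (\<lambda>y x. F x y)"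
    and x1: "affine_minorants Y (F x1) \<noteq> {}"
  shows "affine_minorants Y (F x) \<noteq> {}"
proof -
  obtain B where B: "\<And>y. \<bar>F x1 y - F x y\<bar> \<le> B"
    using uniformly_locally_lipschitz_bounded_difference[OF lip, of x1 x] by blast
  obtain a g where "(a, g) \<in> affine_minorants Y (F x1)"
    using x1 by fastforce
  moreover have "F x1 y - B \<le> F x y" for y
    using B[of y] by linarith
  ultimately have "(a - B, g) \<in> affine_minorants Y (F x)"
    by (rule affine_minorants_shift)
  then show ?thesis by blast
qed

text \<open>The envelope for the parameter \<open>x0\<close> is convex on an open set, hence continuous, hence bounded on a
  small ball. Changing the parameter moves the envelope by at most \<open>L\<close> times the
  distance, so the bound persists for nearby parameters.\<close>

lemma convex_envelope_family_local_bounds: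
  fixes F :: "'a::euclidean_space \<Rightarrow> 'a \<Rightarrow> real"
  assumes lip: "uniformly_locally_lipschitz (\<lambda>y x. F x y)"
    and x1: "affine_minorants Y (F x1) \<noteq> {}"
    and \<Omega>: "open \<Omega>" "\<Omega> \<subseteq> convex hull Y" "x0 \<in> \<Omega>"
  obtains r L M where "r > 0" "L \<ge> 0" "cball x0 (2 * r) \<subseteq> \<Omega>"
    "\<And>x x' z. \<lbrakk>x \<in> cball x0 (2 * r); x' \<in> cball x0 (2 * r); z \<in> cball x0 (2 * r)\<rbrakk> \<Longrightarrow>
       \<bar>convex_envelope Y (F x) z - convex_envelope Y (F x') z\<bar> \<le> L * dist x x'"
    "\<And>x z. \<lbrakk>x \<in> cball x0 (2 * r); z \<in> cball x0 (2 * r)\<rbrakk> \<Longrightarrow> \<bar>convex_envelope Y (F x) z\<bar> \<le> M"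
proof -
  note ne = affine_minorants_nonempty_family[OF lip x1]
  let ?H = "\<lambda>x. convex_envelope Y (F x)"
  obtain s L where s: "s > 0" and L: "\<And>y. L-lipschitz_on (cball x0 s) (\<lambda>x. F x y)"
    using lip unfolding uniformly_locally_lipschitz_def by blast
  obtain e where e: "e > 0" "cball x0 e \<subseteq> \<Omega>"
    using \<Omega> open_contains_cball by blast
  define r where "r = min s e / 2"
  have r: "r > 0" "cball x0 (2 * r) \<subseteq> \<Omega>" "cball x0 (2 * r) \<subseteq> cball x0 s"
    using s e by (auto simp: r_def)
  have L0: "L \<ge> 0"
    using L lipschitz_on_nonneg by blast
  have shift: "?H x z - L * dist x x' \<le> ?H x' z"
    if "x \<in> cball x0 (2 * r)" "x' \<in> cball x0 (2 * r)" "z \<in> cball x0 (2 * r)" for x x' z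
  proof (rule convex_envelope_shift[OF ne])
    have "x \<in> cball x0 s" "x' \<in> cball x0 s"
      using that r(3) by blast+
    then show "F x y - L * dist x x' \<le> F x' y" for y
      using lipschitz_onD[OF L, of x x' y] by (simp add: dist_real_def)
    show "z \<in> convex hull Y"
      using that r \<Omega> by blast
  qed
  have H: "\<bar>?H x z - ?H x' z\<bar> \<le> L * dist x x'"
    if "x \<in> cball x0 (2 * r)" "x' \<in> cball x0 (2 * r)" "z \<in> cball x0 (2 * r)" for x x' z
    using shift[of x x' z] shift[of x' x z] that by (simp add: dist_commute abs_le_iff)
  have cvx: "convex_on (interior (convex hull Y)) (?H x0)"
    by (rule convex_on_subset[OF convex_on_convex_envelope[OF ne]])
      (use interior_subset in \<open>auto intro: convex_interior\<close>)
  have "continuous_on (interior (convex hull Y)) (?H x0)"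
    by (intro convex_on_continuous cvx) auto
  then have "continuous_on (cball x0 (2 * r)) (?H x0)"
    by (rule continuous_on_subset) (use r \<Omega> interior_maximal in blast)
  then have "bounded (?H x0 ` cball x0 (2 * r))"
    by (intro compact_imp_bounded compact_continuous_image) auto
  then obtain M where M: "\<And>z. z \<in> cball x0 (2 * r) \<Longrightarrow> \<bar>?H x0 z\<bar> \<le> M"
    unfolding bounded_iff real_norm_def by blast
  have "\<bar>?H x z\<bar> \<le> M + L * (2 * r)" if "x \<in> cball x0 (2 * r)" "z \<in> cball x0 (2 * r)" for x z
  proof -
    have "\<bar>?H x z - ?H x0 z\<bar> \<le> L * dist x x0"
      using H[of x x0 z] that r by simp
    also have "\<dots> \<le> L * (2 * r)"
      using that L0 by (intro mult_left_mono) (auto simp: dist_commute)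
    finally show ?thesis
      using M[OF that(2)] by linarith
  qed
  with r L0 H show ?thesis
    by (intro that[of r L "M + L * (2 * r)"]) auto
qed

text \<open>Move the two arguments one at a time: first the point, using the uniform local bound for
  convex functions, then the parameter.\<close>

lemma locally_lipschitz_diagonal_convex_envelope:
  fixes F :: "'a::euclidean_space \<Rightarrow> 'a \<Rightarrow> real"
  assumes lip: "uniformly_locally_lipschitz (\<lambda>y x. F x y)"
    and x1: "affine_minorants Y (F x1) \<noteq> {}"
    and \<Omega>: "open \<Omega>" "\<Omega> \<subseteq> convex hull Y"
  shows "locally_lipschitz_on \<Omega> (\<lambda>x. convex_envelope Y (F x) x)"
  unfolding locally_lipschitz_on_def
proof
  fix x0 assume x0: "x0 \<in> \<Omega>"
  let ?H = "\<lambda>x. convex_envelope Y (F x)"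
  obtain r L M where r: "r > 0" "L \<ge> 0" "cball x0 (2 * r) \<subseteq> \<Omega>"
    and L: "\<And>x x' z. \<lbrakk>x \<in> cball x0 (2 * r); x' \<in> cball x0 (2 * r); z \<in> cball x0 (2 * r)\<rbrakk> \<Longrightarrow>
       \<bar>?H x z - ?H x' z\<bar> \<le> L * dist x x'"
    and M: "\<And>x z. \<lbrakk>x \<in> cball x0 (2 * r); z \<in> cball x0 (2 * r)\<rbrakk> \<Longrightarrow> \<bar>?H x z\<bar> \<le> M"
    by (rule convex_envelope_family_local_bounds[OF lip x1 \<Omega> x0]) blast
  have M0: "M \<ge> 0"
    using M[of x0 x0] r by auto
  have lipz: "(2 * M / r)-lipschitz_on (cball x0 r) (?H x)" if "x \<in> cball x0 r" for x
  proof (rule convex_on_bounded_imp_lipschitz)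
    show "convex_on (cball x0 (2 * r)) (?H x)"
      by (rule convex_on_subset[OF convex_on_convex_envelope
            [OF affine_minorants_nonempty_family[OF lip x1]]])
        (use r \<Omega> in auto)
    show "\<bar>?H x z\<bar> \<le> M" if "z \<in> cball x0 (2 * r)" for z
      using M that \<open>x \<in> cball x0 r\<close> r by auto
  qed (use r in simp)
  have "(2 * M / r + L)-lipschitz_on (cball x0 r \<inter> \<Omega>) (\<lambda>x. ?H x x)"
  proof (rule lipschitz_onI)
    fix x y assume "x \<in> cball x0 r \<inter> \<Omega>" "y \<in> cball x0 r \<inter> \<Omega>"
    then have xy: "x \<in> cball x0 r" "y \<in> cball x0 r" by auto
    have "\<bar>?H x x - ?H x y\<bar> \<le> 2 * M / r * dist x y"
      using lipschitz_onD[OF lipz xy] xy by (simp add: dist_real_def)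
    moreover have "\<bar>?H x y - ?H y y\<bar> \<le> L * dist x y"
      using L[of x y y] xy r by simp
    ultimately have "\<bar>?H x x - ?H y y\<bar> \<le> 2 * M / r * dist x y + L * dist x y"
      by linarith
    then show "dist (?H x x) (?H y y) \<le> (2 * M / r + L) * dist x y"
      by (simp add: dist_real_def algebra_simps)
  qed (use M0 r in simp)
  with r show "\<exists>r>0. \<exists>L. L-lipschitz_on (cball x0 r \<inter> \<Omega>) (\<lambda>x. ?H x x)"
    by blast
qed

text \<open>Stepping from \<open>x\<close> by a fixed length \<open>r\<close> in the direction of a subgradient \<open>g x\<close> raises the envelope
  by at least \<open>r * norm (g x)\<close>, while the envelope is locally bounded uniformly in the parameter.
  Zero vectors are exempt from the subgradient condition, so \<open>g\<close> may be set to \<open>0\<close>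
  where no subgradient is prescribed.\<close>

lemma locally_bounded_on_subgradients:
  fixes F :: "'a::euclidean_space \<Rightarrow> 'a \<Rightarrow> real"
  assumes lip: "uniformly_locally_lipschitz (\<lambda>y x. F x y)"
    and x1: "affine_minorants Y (F x1) \<noteq> {}"
    and \<Omega>: "open \<Omega>" "\<Omega> \<subseteq> convex hull Y"
    and sub: "\<And>x z. \<lbrakk>x \<in> \<Omega>; z \<in> \<Omega>; g x \<noteq> 0\<rbrakk> \<Longrightarrow>
        convex_envelope Y (F x) x + g x \<bullet> (z - x) \<le> convex_envelope Y (F x) z"
  shows "locally_bounded_on \<Omega> g"
  unfolding locally_bounded_on_def
proof
  fix x0 assume x0: "x0 \<in> \<Omega>"
  let ?H = "\<lambda>x. convex_envelope Y (F x)"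
  obtain r M where r: "r > 0" "cball x0 (2 * r) \<subseteq> \<Omega>"
    and M: "\<And>x z. \<lbrakk>x \<in> cball x0 (2 * r); z \<in> cball x0 (2 * r)\<rbrakk> \<Longrightarrow> \<bar>?H x z\<bar> \<le> M"
    by (rule convex_envelope_family_local_bounds[OF lip x1 \<Omega> x0]) blast
  have M0: "M \<ge> 0"
    using M[of x0 x0] r by auto
  have "norm (g x) \<le> 2 * M / r" if x: "x \<in> cball x0 r" for x
  proof (cases "g x = 0")
    case False
    define z where "z = x + (r / norm (g x)) *\<^sub>R g x"
    have "dist x0 z \<le> dist x0 x + dist x z"
      by (rule dist_triangle)
    also have "dist x z = r"
      using False r by (simp add: z_def dist_norm)
    finally have z: "z \<in> cball x0 (2 * r)"
      using x by simp
    have x2: "x \<in> cball x0 (2 * r)"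
      using x r by simp
    have "g x \<bullet> (z - x) = r * norm (g x)"
      using False by (simp add: z_def dot_square_norm power2_eq_square)
    moreover have "?H x x + g x \<bullet> (z - x) \<le> ?H x z"
      by (rule sub) (use x2 z r False in auto)
    ultimately have "r * norm (g x) \<le> 2 * M"
      using M[OF x2 x2] M[OF x2 z] by linarith
    with r show ?thesis
      by (simp add: field_simps)
  qed (use M0 r in simp)
  then have "bounded (g ` (cball x0 r \<inter> \<Omega>))"
    unfolding bounded_iff by (intro exI[of _ "2 * M / r"]) auto
  with r show "\<exists>r>0. bounded (g ` (cball x0 r \<inter> \<Omega>))"
    by blast
qed

section \<open>Regularity of the exposing triple\<close>

lemma locally_bounded_on_minus:
  fixes g :: "'a::metric_space \<Rightarrow> 'b::real_normed_vector"
  shows "locally_bounded_on S (\<lambda>x. - g x) \<longleftrightarrow> locally_bounded_on S g"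
  by (simp add: locally_bounded_on_def bounded_iff)

lemma affine_minorant_of_dominated:
  assumes "\<And>y. y \<in> Y \<Longrightarrow> c y \<le> b y - a - g \<bullet> (y - x)"
  shows "(a - g \<bullet> x, g) \<in> affine_minorants Y (\<lambda>y. b y - c y)"
proof -
  have "a - g \<bullet> x + g \<bullet> y \<le> b y - c y" if "y \<in> Y" for y
    using assms[OF that] by (simp add: inner_diff_right)
  then show ?thesis
    by (simp add: affine_minorants_def)
qed

text \<open>Here \<open>T\<close> is where the prescribed affine minorant, of value \<open>a\<close> at \<open>x\<close>, touches \<open>b - c\<close>. Every
  other affine minorant lies below it on \<open>T\<close>, and the comparison of two affine
  functions extends from \<open>T\<close> to its convex hull, in particular to \<open>x\<close>.\<close>

lemma convex_envelope_eq_of_contact: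
  assumes dom: "\<And>y. y \<in> Y \<Longrightarrow> c y \<le> b y - a - g \<bullet> (y - x)"
    and x: "x \<in> convex hull T" and T: "T \<subseteq> Y"
    and eq: "\<And>y. y \<in> T \<Longrightarrow> b y - a - g \<bullet> (y - x) = c y"
  shows "convex_envelope Y (\<lambda>y. b y - c y) x = a"
proof (rule antisym)
  note ag = affine_minorant_of_dominated[of Y c b a g x, OF dom]
  have "x \<in> convex hull Y"
    using x T hull_mono by blast
  from convex_envelope_upper[OF ag this]
  show "a \<le> convex_envelope Y (\<lambda>y. b y - c y) x"
    by simp
  show "convex_envelope Y (\<lambda>y. b y - c y) x \<le> a"
  proof (rule convex_envelope_least)
    fix a' g' assume m: "(a', g') \<in> affine_minorants Y (\<lambda>y. b y - c y)"
    let ?S = "{z. (g' - g) \<bullet> z \<le> a - g \<bullet> x - a'}"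
    have "T \<subseteq> ?S"
    proof
      fix y assume y: "y \<in> T"
      then have "a' + g' \<bullet> y \<le> b y - c y"
        using m T by (auto simp: affine_minorants_def)
      with eq[OF y] show "y \<in> ?S"
        by (simp add: inner_diff_left inner_diff_right)
    qed
    then have "convex hull T \<subseteq> ?S"
      by (intro hull_minimal convex_halfspace_le)
    with x show "a' + g' \<bullet> x \<le> a"
      by (auto simp: inner_diff_left)
  qed (use ag in blast)
qed

text \<open>The contact hypothesis pins the envelope at each \<open>x \<in> X\<close> to \<open>a x\<close>, which turns the affine
  minorant coming from admissibility into a subgradient inequality for \<open>g x\<close> there. So \<open>A\<close> extends
  \<open>a\<close>, and the bound for subgradients of a family of envelopes applies to \<open>g\<close>.\<close>

lemma dominating_triple_regularity:
  fixes c :: "'a::euclidean_space \<Rightarrow> 'a \<Rightarrow> real"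
  assumes lip: "uniformly_locally_lipschitz (\<lambda>y x. c x y)"
    and X: "X \<noteq> {}"
    and dom: "\<forall>x\<in>X. \<forall>y\<in>Y. c x y \<le> b y - a x - g x \<bullet> (y - x)"
    and eq: "\<forall>x\<in>X. x \<in> convex hull {y \<in> Y. b y - a x - g x \<bullet> (y - x) = c x y}"
    and \<Omega>: "open \<Omega>" "\<Omega> \<subseteq> convex hull Y"
  defines "A \<equiv> \<lambda>x. convex_envelope Y (\<lambda>y. b y - c x y) x"
  shows "locally_lipschitz_on \<Omega> A"
    and "\<forall>x\<in>X. A x = a x"
    and "locally_bounded_on \<Omega> (\<lambda>x. if x \<in> X then g x else 0)"
proof -
  obtain x1 where x1: "x1 \<in> X"
    using X by blast
  have lipF: "uniformly_locally_lipschitz (\<lambda>y x. b y - c x y)"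
    using lip unfolding uniformly_locally_lipschitz_def lipschitz_on_def
    by (simp add: dist_real_def abs_minus_commute)
  have minor: "(a x - g x \<bullet> x, g x) \<in> affine_minorants Y (\<lambda>y. b y - c x y)" if "x \<in> X" for x
    using dom that by (intro affine_minorant_of_dominated) auto
  then have ne: "affine_minorants Y (\<lambda>y. b y - c x1 y) \<noteq> {}"
    using x1 by blast
  show "locally_lipschitz_on \<Omega> A"
    unfolding A_def by (rule locally_lipschitz_diagonal_convex_envelope[OF lipF ne \<Omega>])
  have A: "A x = a x" if "x \<in> X" for x
    unfolding A_def
    by (rule convex_envelope_eq_of_contact[OF _ bspec[OF eq that]]) (use dom that in auto)
  then show "\<forall>x\<in>X. A x = a x"
    by blast
  show "locally_bounded_on \<Omega> (\<lambda>x. if x \<in> X then g x else 0)"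
  proof (rule locally_bounded_on_subgradients[OF lipF ne \<Omega>])
    fix x z assume "z \<in> \<Omega>" and nz: "(if x \<in> X then g x else 0) \<noteq> 0"
    then have x: "x \<in> X" by (auto split: if_splits)
    have "convex_envelope Y (\<lambda>y. b y - c x y) x = a x"
      using A[OF x] by (simp add: A_def)
    moreover have "a x - g x \<bullet> x + g x \<bullet> z \<le> convex_envelope Y (\<lambda>y. b y - c x y) z"
      using convex_envelope_upper[OF minor[OF x]] \<open>z \<in> \<Omega>\<close> \<Omega> by blast
    ultimately show "convex_envelope Y (\<lambda>y. b y - c x y) x + (if x \<in> X then g x else 0) \<bullet> (z - x)
        \<le> convex_envelope Y (\<lambda>y. b y - c x y) z"
      using x by (simp add: inner_diff_right)
  qed
qed

text \<open>By the triangle inequality, replacing \<open>norm (x - z)\<close> by \<open>norm (y - z)\<close> costs at most \<open>norm (x - y)\<close>, so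
  lowering the affine minorant at \<open>x\<close> by that amount gives one at \<open>y\<close>. By contact, its value at \<open>y\<close> is
  exactly \<open>b y\<close>, the largest value possible because \<open>norm (y - y) = 0\<close>.\<close>

lemma diagonal_convex_envelope_eq_of_contact:
  fixes b :: "'a::real_inner \<Rightarrow> real"
  assumes dom: "\<And>z. z \<in> Y \<Longrightarrow> - norm (x - z) \<le> b z - a - g \<bullet> (z - x)"
    and eq: "b y - a - g \<bullet> (y - x) = - norm (x - y)" and y: "y \<in> Y"
  shows "convex_envelope Y (\<lambda>z. b z + norm (y - z)) y = b y"
proof (rule antisym)
  have "a - g \<bullet> x - norm (x - y) + g \<bullet> z \<le> b z + norm (y - z)" if "z \<in> Y" for z
    using dom[OF that] norm_triangle_ineq[of "x - y" "y - z"] by (simp add: inner_diff_right)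
  then have m: "(a - g \<bullet> x - norm (x - y), g) \<in> affine_minorants Y (\<lambda>z. b z + norm (y - z))"
    by (simp add: affine_minorants_def)
  have "a - g \<bullet> x - norm (x - y) + g \<bullet> y \<le> convex_envelope Y (\<lambda>z. b z + norm (y - z)) y"
    by (rule convex_envelope_upper[OF m hull_inc[OF y]])
  moreover have "a - g \<bullet> x - norm (x - y) + g \<bullet> y = b y"
    using eq by (simp add: inner_diff_right)
  ultimately show "b y \<le> convex_envelope Y (\<lambda>z. b z + norm (y - z)) y"
    by simp
  show "convex_envelope Y (\<lambda>z. b z + norm (y - z)) y \<le> b y"
  proof (rule convex_envelope_least)
    fix a' g' assume "(a', g') \<in> affine_minorants Y (\<lambda>z. b z + norm (y - z))"
    with y have "a' + g' \<bullet> y \<le> b y + norm (y - y)"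
      by (auto simp only: affine_minorants_def mem_Collect_eq prod.case)
    then show "a' + g' \<bullet> y \<le> b y"
      by simp
  qed (use m in blast)
qed

section \<open>Contact layers and extended convex functions\<close>

text \<open>Measurability of a triple refers to the traces on \<open>X\<close> and \<open>Y\<close> only, so it survives arbitrary
  changes outside these sets, such as cutting \<open>\<gamma>\<close> off to \<open>0\<close> outside a set that need not be Borel.\<close>

lemma contact_layer_in_cong:
  assumes \<alpha>: "\<And>x. x \<in> X \<Longrightarrow> \<alpha> x = \<alpha>' x" and \<gamma>: "\<And>x. x \<in> X \<Longrightarrow> \<gamma> x = \<gamma>' x"
    and \<beta>: "\<And>y. y \<in> Y \<Longrightarrow> \<beta> y = \<beta>' y"
  shows "contact_layer_in c X Y (\<alpha>, \<gamma>, \<beta>) \<Gamma> \<longleftrightarrow> contact_layer_in c X Y (\<alpha>', \<gamma>', \<beta>') \<Gamma>"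
proof -
  have "\<alpha> \<in> borel_measurable (restrict_space borel X) \<longleftrightarrow>
      \<alpha>' \<in> borel_measurable (restrict_space borel X)"
    by (rule measurable_cong) (simp add: \<alpha> space_restrict_space)
  moreover have "\<gamma> \<in> borel_measurable (restrict_space borel X) \<longleftrightarrow>
      \<gamma>' \<in> borel_measurable (restrict_space borel X)"
    by (rule measurable_cong) (simp add: \<gamma> space_restrict_space)
  moreover have "\<beta> \<in> borel_measurable (restrict_space borel Y) \<longleftrightarrow>
      \<beta>' \<in> borel_measurable (restrict_space borel Y)"
    by (rule measurable_cong) (simp add: \<beta> space_restrict_space)
  ultimately have meas: "(\<alpha>, \<gamma>, \<beta>) \<in> meas_triple X Y \<longleftrightarrow> (\<alpha>', \<gamma>', \<beta>') \<in> meas_triple X Y"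
    by (simp add: meas_triple_def)
  have eq: "\<beta> y - \<alpha> x - \<gamma> x \<bullet> (y - x) = \<beta>' y - \<alpha>' x - \<gamma>' x \<bullet> (y - x)" if "x \<in> X" "y \<in> Y" for x y
    using \<alpha> \<beta> \<gamma> that by simp
  have "contact_set c X Y (\<alpha>, \<gamma>, \<beta>) = contact_set c X Y (\<alpha>', \<gamma>', \<beta>')"
    using eq by (auto simp: contact_set_def)
  moreover have "(\<alpha>, \<gamma>, \<beta>) \<in> E_min c X Y \<longleftrightarrow> (\<alpha>', \<gamma>', \<beta>') \<in> E_min c X Y"
    using meas eq by (simp add: E_min_def)
  moreover have "(\<alpha>, \<gamma>, \<beta>) \<in> E_max c X Y \<longleftrightarrow> (\<alpha>', \<gamma>', \<beta>') \<in> E_max c X Y"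
    using meas eq by (simp add: E_max_def)
  ultimately show ?thesis
    by (simp add: contact_layer_in_def)
qed

text \<open>The epigraph of a supremum is the intersection of the epigraphs.\<close>

lemma ext_convex_SUP:
  assumes "X \<noteq> {}" "\<And>x. x \<in> X \<Longrightarrow> convex_on UNIV (f x)"
  shows "ext_convex (\<lambda>y. SUP x\<in>X. ereal (f x y))"
  unfolding ext_convex_def
proof (intro conjI allI)
  fix y
  obtain x where "x \<in> X" using assms(1) by blast
  then have "ereal (f x y) \<le> (SUP x\<in>X. ereal (f x y))"
    by (rule SUP_upper)
  then show "(SUP x\<in>X. ereal (f x y)) \<noteq> - \<infinity>"
    by auto
next
  have "{(y, t). (SUP x\<in>X. ereal (f x y)) \<le> ereal t} = (\<Inter>x\<in>X. epigraph UNIV (f x))"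
    by (auto simp: epigraph_def SUP_le_iff)
  also have "convex \<dots>"
    using assms(2) by (intro convex_INT) (simp add: convex_epigraph)
  finally show "convex {(y, t). (SUP x\<in>X. ereal (f x y)) \<le> ereal t}" .
qed

text \<open>The effective domain is the projection of the epigraph, hence convex.\<close>

lemma ext_convex_finite_on_hull:
  assumes f: "ext_convex f" and Y: "\<And>y. y \<in> Y \<Longrightarrow> f y \<noteq> \<infinity>" and z: "z \<in> convex hull Y"
  shows "f z \<noteq> \<infinity>"
proof -
  have finite_iff: "f x \<noteq> \<infinity> \<longleftrightarrow> (\<exists>t. f x \<le> ereal t)" for x
    by (cases "f x") auto
  have "{x. f x \<noteq> \<infinity>} = fst ` {(x, t). f x \<le> ereal t}"
    unfolding finite_iff by (auto simp: image_iff)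
  moreover have "convex (fst ` {(x, t). f x \<le> ereal t})"
    using f by (intro convex_linear_image linear_fst) (simp add: ext_convex_def)
  ultimately have "convex {x. f x \<noteq> \<infinity>}"
    by simp
  then have "convex hull Y \<subseteq> {x. f x \<noteq> \<infinity>}"
    using Y by (intro hull_minimal) auto
  with z show ?thesis by blast
qed

section \<open>Regular representatives of a contact layer\<close>

theorem theorem2p3:
  fixes c :: "'a::euclidean_space \<Rightarrow> 'a \<Rightarrow> real"
    and \<Gamma> :: "('a \<times> 'a) set"
    and \<Omega> :: "'a set"
    and \<alpha>0 :: "'a \<Rightarrow> real" and \<gamma>0 :: "'a \<Rightarrow> 'a" and \<beta>0 :: "'a \<Rightarrow> real"
  assumes c_lip_x: "uniformly_locally_lipschitz (\<lambda>y x. c x y)"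
    and c_lip_y: "uniformly_locally_lipschitz (\<lambda>x y. c x y)"
    and \<Gamma>_MT: "\<Gamma> \<in> S_MT"
    and \<Gamma>_layer: "contact_layer c (\<alpha>0, \<gamma>0, \<beta>0) \<Gamma>"
    and \<Omega>_eq: "\<Omega> = IC (snd ` \<Gamma>)"
    and \<Omega>_open: "open \<Omega>"
    and X_sub: "fst ` \<Gamma> \<subseteq> \<Omega>"
  shows
    "(\<exists>\<alpha> \<gamma> \<beta>. locally_lipschitz_on \<Omega> \<alpha> \<and> locally_bounded_on \<Omega> \<gamma> \<and>
        contact_layer c (\<alpha>, \<gamma>, \<beta>) \<Gamma>)
     \<and>
     ((\<alpha>0, \<gamma>0, \<beta>0) \<in> E_max c (fst ` \<Gamma>) (snd ` \<Gamma>) \<and> (\<forall>x. convex_on UNIV (c x)) \<longrightarrow>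
      (\<exists>\<alpha> \<gamma> (\<beta> :: 'a \<Rightarrow> ereal). locally_lipschitz_on \<Omega> \<alpha> \<and> locally_bounded_on \<Omega> \<gamma> \<and>
        ext_convex \<beta> \<and> (\<forall>y\<in>convex hull (snd ` \<Gamma>). \<beta> y \<noteq> \<infinity>) \<and>
        contact_layer c (\<alpha>, \<gamma>, \<lambda>y. real_of_ereal (\<beta> y)) \<Gamma>))
     \<and>
     ((\<alpha>0, \<gamma>0, \<beta>0) \<in> E_min c (fst ` \<Gamma>) (snd ` \<Gamma>) \<and> (\<forall>x y. c x y = norm (x - y)) \<longrightarrow>
      (\<exists>\<alpha> \<gamma> \<beta>. locally_lipschitz_on \<Omega> \<alpha> \<and> locally_bounded_on \<Omega> \<gamma> \<and>
        contact_layer c (\<alpha>, \<gamma>, \<beta>) \<Gamma> \<and> (\<forall>x\<in>\<Omega>. \<alpha> x = \<beta> x)))"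
proof -
  let ?X = "fst ` \<Gamma>" and ?Y = "snd ` \<Gamma>"
  let ?\<gamma> = "\<lambda>x. if x \<in> ?X then \<gamma>0 x else 0"
  have X: "?X \<noteq> {}" and adm: "(\<alpha>0, \<gamma>0, \<beta>0) \<in> E_min c ?X ?Y \<union> E_max c ?X ?Y"
    and con: "\<And>x y. (x, y) \<in> \<Gamma> \<Longrightarrow> \<beta>0 y - \<alpha>0 x - \<gamma>0 x \<bullet> (y - x) = c x y"
    using \<Gamma>_layer by (auto simp: contact_layer_def contact_layer_in_def contact_set_def)
  have hull: "\<Omega> \<subseteq> convex hull ?Y"
    by (simp add: \<Omega>_eq IC_def rel_interior_subset)
  have bary: "\<forall>x\<in>?X. x \<in> convex hull {y \<in> ?Y. \<beta>0 y - \<alpha>0 x - \<gamma>0 x \<bullet> (y - x) = c x y}"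
  proof
    fix x assume x: "x \<in> ?X"
    have "x \<in> convex hull (\<Gamma> `` {x})"
      using \<Gamma>_MT x rel_interior_subset unfolding S_MT_def IC_def by blast
    moreover have "\<Gamma> `` {x} \<subseteq> {y \<in> ?Y. \<beta>0 y - \<alpha>0 x - \<gamma>0 x \<bullet> (y - x) = c x y}"
    proof
      fix y assume "y \<in> \<Gamma> `` {x}"
      then have "(x, y) \<in> \<Gamma>" by simp
      from con[OF this] imageI[OF this, of snd]
      show "y \<in> {y \<in> ?Y. \<beta>0 y - \<alpha>0 x - \<gamma>0 x \<bullet> (y - x) = c x y}" by simp
    qed
    ultimately show "x \<in> convex hull {y \<in> ?Y. \<beta>0 y - \<alpha>0 x - \<gamma>0 x \<bullet> (y - x) = c x y}"
      using hull_mono by blast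
  qed
  \<comment> \<open>The new functions never change the given triple on \<open>X \<times> Y\<close>, so contact and
    measurability carry over.\<close>
  have keep: "contact_layer c (\<alpha>, ?\<gamma>, \<beta>) \<Gamma>"
    if "\<And>x. x \<in> ?X \<Longrightarrow> \<alpha> x = \<alpha>0 x" "\<And>y. y \<in> ?Y \<Longrightarrow> \<beta> y = \<beta>0 y" for \<alpha> \<beta>
    using \<Gamma>_layer contact_layer_in_cong[of ?X \<alpha> \<alpha>0 ?\<gamma> \<gamma>0 ?Y \<beta> \<beta>0 c \<Gamma>] that
    unfolding contact_layer_def by simp

  have max_case: "\<exists>\<alpha>. locally_lipschitz_on \<Omega> \<alpha> \<and> locally_bounded_on \<Omega> ?\<gamma> \<and> (\<forall>x\<in>?X. \<alpha> x = \<alpha>0 x)"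
    if E: "(\<alpha>0, \<gamma>0, \<beta>0) \<in> E_max c ?X ?Y"
  proof -
    have dom: "\<forall>x\<in>?X. \<forall>y\<in>?Y. c x y \<le> \<beta>0 y - \<alpha>0 x - \<gamma>0 x \<bullet> (y - x)"
      using E unfolding E_max_def by blast
    note reg = dominating_triple_regularity[OF c_lip_x X dom bary \<Omega>_open hull]
    show ?thesis
      by (rule exI, rule conjI, rule reg(1), rule conjI, rule reg(3), rule reg(2))
  qed

  have min_case: "\<exists>\<alpha>. locally_lipschitz_on \<Omega> \<alpha> \<and> locally_bounded_on \<Omega> ?\<gamma> \<and> (\<forall>x\<in>?X. \<alpha> x = \<alpha>0 x) \<and>
      ((\<forall>x y. c x y = norm (x - y)) \<longrightarrow> (\<forall>y\<in>?Y. \<alpha> y = \<beta>0 y))"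
    if E: "(\<alpha>0, \<gamma>0, \<beta>0) \<in> E_min c ?X ?Y"
  proof -
    \<comment> \<open>Negating \<open>c\<close> and the triple turns a triple below \<open>c\<close> into one above \<open>- c\<close>, so that affine
      minorants and convex envelopes apply to both kinds of triple.\<close>
    let ?c = "\<lambda>x y. - c x y"
    let ?A = "\<lambda>x. convex_envelope ?Y (\<lambda>y. - \<beta>0 y - ?c x y) x"
    have lip: "uniformly_locally_lipschitz (\<lambda>y x. ?c x y)"
      using c_lip_x by (simp add: uniformly_locally_lipschitz_def)
    have dom: "\<forall>x\<in>?X. \<forall>y\<in>?Y. ?c x y \<le> - \<beta>0 y - - \<alpha>0 x - - \<gamma>0 x \<bullet> (y - x)"
    proof (intro ballI)
      fix x y assume "x \<in> ?X" "y \<in> ?Y"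
      have "\<beta>0 y - \<alpha>0 x - \<gamma>0 x \<bullet> (y - x) \<le> c x y"
        using \<open>x \<in> ?X\<close> \<open>y \<in> ?Y\<close> E unfolding E_min_def by blast
      then show "?c x y \<le> - \<beta>0 y - - \<alpha>0 x - - \<gamma>0 x \<bullet> (y - x)"
        by (simp only: inner_minus_left)
    qed
    have neg: "- \<beta>0 y - - \<alpha>0 x - - \<gamma>0 x \<bullet> (y - x) = ?c x y \<longleftrightarrow>
        \<beta>0 y - \<alpha>0 x - \<gamma>0 x \<bullet> (y - x) = c x y" for x y
      by (simp only: inner_minus_left) linarith
    have bary': "\<forall>x\<in>?X. x \<in> convex hull {y \<in> ?Y. - \<beta>0 y - - \<alpha>0 x - - \<gamma>0 x \<bullet> (y - x) = ?c x y}"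
      using bary unfolding neg .
    note reg = dominating_triple_regularity[OF lip X dom bary' \<Omega>_open hull]
    have lipA: "locally_lipschitz_on \<Omega> (\<lambda>x. - ?A x)"
      using reg(1) by (simp add: locally_lipschitz_on_def)
    have bdd: "locally_bounded_on \<Omega> ?\<gamma>"
    proof -
      have "(\<lambda>x. if x \<in> ?X then - \<gamma>0 x else 0) = (\<lambda>x. - ?\<gamma> x)"
        by auto
      with reg(3) have "locally_bounded_on \<Omega> (\<lambda>x. - ?\<gamma> x)"
        by simp
      then show ?thesis
        by (simp only: locally_bounded_on_minus)
    qed
    have A: "\<forall>x\<in>?X. - ?A x = \<alpha>0 x"
    proof
      fix x assume "x \<in> ?X"
      with reg(2) have "?A x = - \<alpha>0 x" by (rule bspec)
      then show "- ?A x = \<alpha>0 x" by linarith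
    qed
    have A_norm: "- ?A y = \<beta>0 y" if c: "\<forall>x y. c x y = norm (x - y)" and y: "y \<in> ?Y" for y
    proof -
      obtain x where xy: "(x, y) \<in> \<Gamma>"
        using y by auto
      then have x: "x \<in> ?X" by force
      have "- norm (x - z) \<le> - \<beta>0 z - - \<alpha>0 x - - \<gamma>0 x \<bullet> (z - x)" if "z \<in> ?Y" for z
        using bspec[OF bspec[OF dom x] that] c by simp
      moreover have "- \<beta>0 y - - \<alpha>0 x - - \<gamma>0 x \<bullet> (y - x) = - norm (x - y)"
        using neg[of y x] con[OF xy] c by simp
      ultimately have "convex_envelope ?Y (\<lambda>z. - \<beta>0 z + norm (y - z)) y = - \<beta>0 y"
        using y by (rule diagonal_convex_envelope_eq_of_contact)
      then have "?A y = - \<beta>0 y"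
        using c by simp
      then show ?thesis by simp
    qed
    show ?thesis
      by (intro exI[of _ "\<lambda>x. - ?A x"] conjI impI ballI)
        (fact lipA, fact bdd, erule bspec[OF A], erule (1) A_norm)
  qed

  show ?thesis
  proof (intro conjI impI)
    show "\<exists>\<alpha> \<gamma> \<beta>. locally_lipschitz_on \<Omega> \<alpha> \<and> locally_bounded_on \<Omega> \<gamma> \<and>
        contact_layer c (\<alpha>, \<gamma>, \<beta>) \<Gamma>"
    proof -
      obtain \<alpha> where "locally_lipschitz_on \<Omega> \<alpha>" "locally_bounded_on \<Omega> ?\<gamma>" "\<forall>x\<in>?X. \<alpha> x = \<alpha>0 x"
        using adm max_case min_case by blast
      moreover from this(3) have "contact_layer c (\<alpha>, ?\<gamma>, \<beta>0) \<Gamma>"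
        by (intro keep) (erule bspec, assumption, rule refl)
      ultimately show ?thesis
        by (intro exI conjI)
    qed
  next
    assume *: "(\<alpha>0, \<gamma>0, \<beta>0) \<in> E_max c ?X ?Y \<and> (\<forall>x. convex_on UNIV (c x))"
    obtain \<alpha> where \<alpha>: "locally_lipschitz_on \<Omega> \<alpha>" "locally_bounded_on \<Omega> ?\<gamma>" "\<forall>x\<in>?X. \<alpha> x = \<alpha>0 x"
      using * max_case by blast
    \<comment> \<open>The smallest \<open>\<beta>\<close> compatible with \<open>\<alpha>0\<close> and \<open>\<gamma>0\<close> is a supremum of convex functions. It agrees
      with \<open>\<beta>0\<close> on \<open>Y\<close>, as each point of \<open>Y\<close> is in contact with some point of \<open>X\<close>.\<close>
    define f where "f = (\<lambda>x y. c x y + (\<alpha>0 x + \<gamma>0 x \<bullet> (y - x)))"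
    define \<beta> where "\<beta> = (\<lambda>y. SUP x\<in>?X. ereal (f x y))"
    have affine: "convex_on UNIV (\<lambda>y. \<alpha>0 x + \<gamma>0 x \<bullet> (y - x))" for x
    proof (rule convex_onI)
      fix t y z
      show "\<alpha>0 x + \<gamma>0 x \<bullet> ((1 - t) *\<^sub>R y + t *\<^sub>R z - x)
          \<le> (1 - t) * (\<alpha>0 x + \<gamma>0 x \<bullet> (y - x)) + t * (\<alpha>0 x + \<gamma>0 x \<bullet> (z - x))"
        by (simp add: inner_diff_right inner_add_right algebra_simps)
    qed simp
    have "convex_on UNIV (f x)" for x
      unfolding f_def by (rule convex_on_add) (use * affine in auto)
    then have cvx: "ext_convex \<beta>"
      unfolding \<beta>_def using X by (intro ext_convex_SUP) auto
    have \<beta>Y: "\<beta> y = ereal (\<beta>0 y)" if y: "y \<in> ?Y" for y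
    proof (rule antisym)
      have "f x y \<le> \<beta>0 y" if "x \<in> ?X" for x
      proof -
        have "c x y \<le> \<beta>0 y - \<alpha>0 x - \<gamma>0 x \<bullet> (y - x)"
          using * that y unfolding E_max_def by blast
        then show ?thesis
          by (simp add: f_def)
      qed
      then show "\<beta> y \<le> ereal (\<beta>0 y)"
        unfolding \<beta>_def by (intro SUP_least) simp
      obtain x where xy: "(x, y) \<in> \<Gamma>"
        using y by auto
      then have "x \<in> ?X" by force
      then have "ereal (f x y) \<le> \<beta> y"
        unfolding \<beta>_def by (rule SUP_upper)
      moreover have "f x y = \<beta>0 y"
        using con[OF xy] by (simp add: f_def)
      ultimately show "ereal (\<beta>0 y) \<le> \<beta> y"
        by simp
    qed
    have fin: "\<forall>y\<in>convex hull ?Y. \<beta> y \<noteq> \<infinity>"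
    proof
      fix y assume y: "y \<in> convex hull ?Y"
      show "\<beta> y \<noteq> \<infinity>"
        by (rule ext_convex_finite_on_hull[OF cvx _ y]) (simp only: \<beta>Y, simp)
    qed
    have layer: "contact_layer c (\<alpha>, ?\<gamma>, \<lambda>y. real_of_ereal (\<beta> y)) \<Gamma>"
      by (intro keep) (erule bspec[OF \<alpha>(3)], simp only: \<beta>Y real_of_ereal.simps)
    show "\<exists>\<alpha> \<gamma> (\<beta> :: 'a \<Rightarrow> ereal). locally_lipschitz_on \<Omega> \<alpha> \<and> locally_bounded_on \<Omega> \<gamma> \<and>
        ext_convex \<beta> \<and> (\<forall>y\<in>convex hull ?Y. \<beta> y \<noteq> \<infinity>) \<and>
        contact_layer c (\<alpha>, \<gamma>, \<lambda>y. real_of_ereal (\<beta> y)) \<Gamma>"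
      using \<alpha>(1,2) cvx fin layer by (intro exI conjI)
  next
    assume *: "(\<alpha>0, \<gamma>0, \<beta>0) \<in> E_min c ?X ?Y \<and> (\<forall>x y. c x y = norm (x - y))"
    obtain \<alpha> where \<alpha>: "locally_lipschitz_on \<Omega> \<alpha>" "locally_bounded_on \<Omega> ?\<gamma>" "\<forall>x\<in>?X. \<alpha> x = \<alpha>0 x"
      "\<forall>y\<in>?Y. \<alpha> y = \<beta>0 y"
      using * min_case by blast
    have layer: "contact_layer c (\<alpha>, ?\<gamma>, \<alpha>) \<Gamma>"
      by (intro keep) (erule bspec[OF \<alpha>(3)], erule bspec[OF \<alpha>(4)])
    show "\<exists>\<alpha> \<gamma> \<beta>. locally_lipschitz_on \<Omega> \<alpha> \<and> locally_bounded_on \<Omega> \<gamma> \<and>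
        contact_layer c (\<alpha>, \<gamma>, \<beta>) \<Gamma> \<and> (\<forall>x\<in>\<Omega>. \<alpha> x = \<beta> x)"
      using \<alpha>(1,2) layer by (intro exI conjI ballI) simp_all
  qed
qed

end
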